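(* Let $\mathbb{K}$ be a field of characteristic zero, let $R$ be a $\mathbb{K}$-algebra, and let $f\in R$ be an element that has a Bernstein-Sato polynomial $b_f(s)$. If $-n$ is the smallest integral root of $b_f(s)$, then $$\frac{1}{f^{n}}\notin D_{R|\mathbb{K}}\cdot\frac{1}{f^{n-1}}\subseteq R_f .$$
   Context: $R$ is a commutative $\mathbb{K}$-algebra (not assumed regular). Rings of differential operators: $D^0_{R|\mathbb{K}}=\operatorname{Hom}_R(R,R)\subseteq\operatorname{End}_{\mathbb{K}}(R)$, $D^i_{R|\mathbb{K}}=\{\delta\in\operatorname{End}_{\mathbb{K}}(R)\mid\delta\circ\mu-\mu\circ\delta\in D^{i-1}_{R|\mathbb{K}}\text{ for all }\mu\in D^0_{R|\mathbb{K}}\}$, and $D_{R|\mathbb{K}}=\bigcup_iD^i_{R|\mathbb{K}}$. $D_{R|\mathbb{K}}[s]$ is the polynomial ring in a central indeterminate $s$. The localization $R_f$ is a left $D_{R|\mathbb{K}}$-module as follows: for $\delta\in D^t_{R|\mathbb{K}}$ and $g\in R$ a power of $f$, set $\delta^{(0),g}=\delta$ and $\delta^{(j),g}=\delta^{(j-1),g}\circ g-g\circ\delta^{(j-1),g}$; then $\delta\cdot\frac{r}{g}=\sum_{j=0}^t(-1)^j\frac{\delta^{(j),g}(r)}{g^{j+1}}$. Bernstein-Sato polynomial: $f\in R$ admits (has) a Bernstein-Sato polynomial if there exist $\delta(s)\in D_{R|\mathbb{K}}[s]$ and a nonzero $b(s)\in\mathbb{K}[s]$ with $\delta(s)f^{s+1}=b(s)f^s$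 for all $s\in\mathbb{N}$ (equality in $R$). In that case the set of all $b(s)\in\mathbb{K}[s]$ for which such a $\delta(s)$ exists is a nonzero ideal of $\mathbb{K}[s]$, and $b_f(s)$ denotes its monic generator.
   Formalization: The theorem assumes n ≥ 1; this is automatic when f is a nonzerodivisor, and the claim is false for n ≤ 0, which occurs only for zero divisors (e.g. R = K, f = 0, where b_f = s, n = 0 and R_f = 0). *)

theory Defs
  imports "HOL-Computational_Algebra.Polynomial" "HOL-Algebra.Ring"
begin

locale comm_algebra = vector_space scale
  for scale :: "'k::field \<Rightarrow> 'r::comm_ring_1 \<Rightarrow> 'r" +
  assumes scale_mult_left: "scale a x * y = scale a (x * y)"

text \<open>\<open>Hom\<^sub>R(R, R)\<close>, the operators of order \<open>0\<close>.\<close>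

definition mult_ops :: "('r::comm_ring_1 \<Rightarrow> 'r) set" where
  "mult_ops = {\<mu>. module_hom (*) (*) \<mu>}"

primrec diff_ops_le :: "('k::field \<Rightarrow> 'r::comm_ring_1 \<Rightarrow> 'r) \<Rightarrow> nat \<Rightarrow> ('r \<Rightarrow> 'r) set" where
  "diff_ops_le scale 0 = mult_ops"
| "diff_ops_le scale (Suc i) =
    {\<delta>. Vector_Spaces.linear scale scale \<delta> \<and>
        (\<forall>\<mu>\<in>mult_ops. (\<lambda>x. (\<delta> \<circ> \<mu>) x - (\<mu> \<circ> \<delta>) x) \<in> diff_ops_le scale i)}"

definition diff_ops :: "('k::field \<Rightarrow> 'r::comm_ring_1 \<Rightarrow> 'r) \<Rightarrow> ('r \<Rightarrow> 'r) set" where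
  "diff_ops scale = (\<Union>i. diff_ops_le scale i)"

text \<open>An element of \<open>D[s]\<close> is given by its finitely supported sequence of coefficients;
  as \<open>s\<close> is central, it can be evaluated at any scalar.\<close>

definition diff_op_polys :: "('k::field \<Rightarrow> 'r::comm_ring_1 \<Rightarrow> 'r) \<Rightarrow> (nat \<Rightarrow> 'r \<Rightarrow> 'r) set" where
  "diff_op_polys scale = {P. (\<forall>i. P i \<in> diff_ops scale) \<and> finite {i. P i \<noteq> (\<lambda>_. 0)}}"

definition eval_op_poly ::
    "('k::field \<Rightarrow> 'r::comm_ring_1 \<Rightarrow> 'r) \<Rightarrow> (nat \<Rightarrow> 'r \<Rightarrow> 'r) \<Rightarrow> 'k \<Rightarrow> 'r \<Rightarrow> 'r" where
  "eval_op_poly scale P a x = (\<Sum>i | P i \<noteq> (\<lambda>_. 0). scale (a ^ i) (P i x))"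

definition bernstein_sato_ideal ::
    "('k::field \<Rightarrow> 'r::comm_ring_1 \<Rightarrow> 'r) \<Rightarrow> 'r \<Rightarrow> 'k poly set" where
  "bernstein_sato_ideal scale f =
    {b. \<exists>P\<in>diff_op_polys scale. \<forall>m::nat.
          eval_op_poly scale P (of_nat m) (f ^ (m + 1)) = scale (poly b (of_nat m)) (f ^ m)}"

definition has_bernstein_sato_poly ::
    "('k::field \<Rightarrow> 'r::comm_ring_1 \<Rightarrow> 'r) \<Rightarrow> 'r \<Rightarrow> bool" where
  "has_bernstein_sato_poly scale f \<longleftrightarrow> (\<exists>b\<in>bernstein_sato_ideal scale f. b \<noteq> 0)"

text \<open>The monic generator; meaningful only if \<open>has_bernstein_sato_poly scale f\<close>, see
  \<open>bernstein_sato_poly_generates\<close> below.\<close>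

definition bernstein_sato_poly ::
    "('k::field \<Rightarrow> 'r::comm_ring_1 \<Rightarrow> 'r) \<Rightarrow> 'r \<Rightarrow> 'k poly" where
  "bernstein_sato_poly scale f =
    (THE b. lead_coeff b = 1 \<and> bernstein_sato_ideal scale f = {p. b dvd p})"

definition powers_of :: "'r::comm_ring_1 \<Rightarrow> 'r set" where
  "powers_of f = range (\<lambda>k::nat. f ^ k)"

text \<open>Elements of \<open>R\<^sub>f\<close> are classes of pairs \<open>(r, g)\<close> with \<open>g\<close> a power of \<open>f\<close>.  Since \<open>f\<close> may be a
  zero divisor, equality of fractions is only required up to multiplication by a power of \<open>f\<close>;
  in particular \<open>R\<^sub>f\<close> may be the zero ring.\<close>

definition loc_rel :: "'r::comm_ring_1 \<Rightarrow> (('r \<times> 'r) \<times> ('r \<times> 'r)) set" where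
  "loc_rel f = {((r, g), (r', g')). g \<in> powers_of f \<and> g' \<in> powers_of f \<and>
                  (\<exists>h\<in>powers_of f. h * (r * g' - r' * g) = 0)}"

definition loc_frac :: "'r::comm_ring_1 \<Rightarrow> 'r \<Rightarrow> 'r \<Rightarrow> ('r \<times> 'r) set" where
  "loc_frac f r g = loc_rel f `` {(r, g)}"

definition localization :: "'r::comm_ring_1 \<Rightarrow> ('r \<times> 'r) set ring" where
  "localization f =
    \<lparr>carrier = (UNIV \<times> powers_of f) // loc_rel f,
     monoid.mult = (\<lambda>X Y. \<Union>x\<in>X. \<Union>y\<in>Y. loc_frac f (fst x * fst y) (snd x * snd y)),
     one = loc_frac f 1 1,
     zero = loc_frac f 0 1,
     add = (\<lambda>X Y. \<Union>x\<in>X. \<Union>y\<in>Y. loc_frac f (fst x * snd y + fst y * snd x) (snd x * snd y))\<rparr>"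

text \<open>\<open>iter_comm j g \<delta>\<close> is the iterated commutator \<open>\<delta>\<^bsup>(j),g\<^esup>\<close>, where
  \<open>\<delta>\<^bsup>(j+1),g\<^esup> = \<delta>\<^bsup>(j),g\<^esup> \<circ> g - g \<circ> \<delta>\<^bsup>(j),g\<^esup>\<close>.\<close>

primrec iter_comm :: "nat \<Rightarrow> 'r::comm_ring_1 \<Rightarrow> ('r \<Rightarrow> 'r) \<Rightarrow> 'r \<Rightarrow> 'r" where
  "iter_comm 0 g \<delta> = \<delta>"
| "iter_comm (Suc j) g \<delta> = (\<lambda>x. iter_comm j g \<delta> (g * x) - g * iter_comm j g \<delta> x)"

definition act_frac :: "'r::comm_ring_1 \<Rightarrow> nat \<Rightarrow> ('r \<Rightarrow> 'r) \<Rightarrow> 'r \<Rightarrow> 'r \<Rightarrow> ('r \<times> 'r) set" where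
  "act_frac f t \<delta> r g =
    (\<Oplus>\<^bsub>localization f\<^esub>j\<in>{..t}. loc_frac f ((-1) ^ j * iter_comm j g \<delta> r) (g ^ (j + 1)))"

text \<open>The value does not depend on the fraction representing \<open>u\<close> nor on the bound \<open>t\<close>
  on the order of \<open>\<delta>\<close>, see \<open>loc_act_frac\<close> below.\<close>

definition loc_act ::
    "('k::field \<Rightarrow> 'r::comm_ring_1 \<Rightarrow> 'r) \<Rightarrow> 'r \<Rightarrow> ('r \<Rightarrow> 'r) \<Rightarrow> ('r \<times> 'r) set \<Rightarrow> ('r \<times> 'r) set" where
  "loc_act scale f \<delta> u =
    (THE v. \<exists>t r g. \<delta> \<in> diff_ops_le scale t \<and> g \<in> powers_of f \<and> u = loc_frac f r g \<and>
                    v = act_frac f t \<delta> r g)"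

text \<open>The set \<open>D \<cdot> u\<close> of all \<open>\<delta> \<cdot> u\<close>; as \<open>D\<close> is a ring acting on \<open>R\<^sub>f\<close>, this is already a submodule.\<close>

definition cyclic_submodule ::
    "('k::field \<Rightarrow> 'r::comm_ring_1 \<Rightarrow> 'r) \<Rightarrow> 'r \<Rightarrow> ('r \<times> 'r) set \<Rightarrow> ('r \<times> 'r) set set" where
  "cyclic_submodule scale f u = (\<lambda>\<delta>. loc_act scale f \<delta> u) ` diff_ops scale"

lemma powers_of_1 [simp]: "1 \<in> powers_of f"
  unfolding powers_of_def by (metis power_0 rangeI)

lemma powers_of_power [simp]: "f ^ k \<in> powers_of f"
  unfolding powers_of_def by blast

lemma powers_of_mult [simp]: "g \<in> powers_of f \<Longrightarrow> h \<in> powers_of f \<Longrightarrow> g * h \<in> powers_of f"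
  unfolding powers_of_def by (auto simp flip: power_add)

lemma powers_of_pow [simp]: "g \<in> powers_of f \<Longrightarrow> g ^ k \<in> powers_of f"
  by (induction k) auto

lemma equiv_loc_rel: "equiv (UNIV \<times> powers_of f) (loc_rel f)"
proof (rule equivI)
  show "loc_rel f \<subseteq> (UNIV \<times> powers_of f) \<times> (UNIV \<times> powers_of f)"
    by (auto simp: loc_rel_def)
  show "refl_on (UNIV \<times> powers_of f) (loc_rel f)"
    by (auto simp: refl_on_def loc_rel_def intro: bexI[of _ 1])
  show "sym (loc_rel f)"
  proof (rule symI)
    fix x y assume "(x, y) \<in> loc_rel f"
    then obtain r g r' g' h where *: "x = (r, g)" "y = (r', g')" "g \<in> powers_of f"
      "g' \<in> powers_of f" "h \<in> powers_of f" "h * (r * g' - r' * g) = 0"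
      by (auto simp: loc_rel_def)
    have "h * (r' * g - r * g') = - (h * (r * g' - r' * g))" by (simp add: algebra_simps)
    with * show "(y, x) \<in> loc_rel f" by (auto simp: loc_rel_def)
  qed
  show "trans (loc_rel f)"
  proof (rule transI)
    fix x y z assume "(x, y) \<in> loc_rel f" "(y, z) \<in> loc_rel f"
    then obtain a p b q c r h k where *: "x = (a, p)" "y = (b, q)" "z = (c, r)"
      "p \<in> powers_of f" "q \<in> powers_of f" "r \<in> powers_of f" "h \<in> powers_of f" "k \<in> powers_of f"
      "h * (a * q - b * p) = 0" "k * (b * r - c * q) = 0"
      by (auto simp: loc_rel_def)
    have "(h * k * q) * (a * r - c * p) =
        k * r * (h * (a * q - b * p)) + h * p * (k * (b * r - c * q))"
      by (simp add: algebra_simps)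
    with * have "(h * k * q) * (a * r - c * p) = 0" by simp
    with * show "(x, z) \<in> loc_rel f"
      by (auto simp: loc_rel_def intro!: bexI[of _ "h * k * q"])
  qed
qed

lemma loc_frac_eq_iff:
  assumes "g \<in> powers_of f" "g' \<in> powers_of f"
  shows "loc_frac f r g = loc_frac f r' g' \<longleftrightarrow> (\<exists>h\<in>powers_of f. h * (r * g' - r' * g) = 0)"
proof -
  have "loc_frac f r g = loc_frac f r' g' \<longleftrightarrow> ((r, g), (r', g')) \<in> loc_rel f"
    unfolding loc_frac_def using assms
    by (intro eq_equiv_class_iff[OF equiv_loc_rel]) auto
  thus ?thesis using assms by (auto simp: loc_rel_def)
qed

lemma loc_frac_eqI:
  assumes "g \<in> powers_of f" "g' \<in> powers_of f" "r * g' = r' * g"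
  shows "loc_frac f r g = loc_frac f r' g'"
  using assms by (subst loc_frac_eq_iff) (auto intro!: bexI[of _ 1])

lemma carrier_localization: "carrier (localization f) = (UNIV \<times> powers_of f) // loc_rel f"
  by (simp add: localization_def)

lemma loc_frac_in_carrier [simp]:
  "g \<in> powers_of f \<Longrightarrow> loc_frac f r g \<in> carrier (localization f)"
  unfolding carrier_localization loc_frac_def by (intro quotientI) auto

lemma localization_cases:
  assumes "u \<in> carrier (localization f)"
  obtains r g where "g \<in> powers_of f" "u = loc_frac f r g"
  using assms unfolding carrier_localization loc_frac_def by (auto elim!: quotientE)

lemma loc_frac_mult:
  fixes f :: "'r::comm_ring_1"
  assumes "g \<in> powers_of f" "g' \<in> powers_of f"
  shows "loc_frac f r g \<otimes>\<^bsub>localization f\<^esub> loc_frac f r' g' = loc_frac f (r * r') (g * g')"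
proof -
  have "congruent2 (loc_rel f) (loc_rel f) (\<lambda>x y. loc_frac f (fst x * fst y) (snd x * snd y))"
  proof (rule congruent2_commuteI[OF equiv_loc_rel])
    fix y z w :: "'r \<times> 'r" assume "w \<in> UNIV \<times> powers_of f" "(y, z) \<in> loc_rel f"
    then obtain a p b q h where *: "y = (a, p)" "z = (b, q)" "p \<in> powers_of f" "q \<in> powers_of f"
      "h \<in> powers_of f" "h * (a * q - b * p) = 0" "snd w \<in> powers_of f"
      by (auto simp: loc_rel_def)
    have "h * (fst w * a * (snd w * q) - fst w * b * (snd w * p)) =
        fst w * snd w * (h * (a * q - b * p))" by (simp add: algebra_simps)
    with * show "loc_frac f (fst w * fst y) (snd w * snd y) =
        loc_frac f (fst w * fst z) (snd w * snd z)"
      by (subst loc_frac_eq_iff) (simp_all, intro bexI[of _ h], simp_all)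
  qed (auto simp: mult.commute)
  from UN_equiv_class2[OF equiv_loc_rel equiv_loc_rel this, of "(r, g)" "(r', g')"] assms
  show ?thesis by (simp add: localization_def loc_frac_def)
qed

lemma loc_frac_add:
  fixes f :: "'r::comm_ring_1"
  assumes "g \<in> powers_of f" "g' \<in> powers_of f"
  shows "loc_frac f r g \<oplus>\<^bsub>localization f\<^esub> loc_frac f r' g' =
    loc_frac f (r * g' + r' * g) (g * g')"
proof -
  have "congruent2 (loc_rel f) (loc_rel f)
      (\<lambda>x y. loc_frac f (fst x * snd y + fst y * snd x) (snd x * snd y))"
  proof (rule congruent2_commuteI[OF equiv_loc_rel])
    fix y z w :: "'r \<times> 'r" assume "w \<in> UNIV \<times> powers_of f" "(y, z) \<in> loc_rel f"
    then obtain a p b q h where *: "y = (a, p)" "z = (b, q)" "p \<in> powers_of f" "q \<in> powers_of f"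
      "h \<in> powers_of f" "h * (a * q - b * p) = 0" "snd w \<in> powers_of f"
      by (auto simp: loc_rel_def)
    have "h * ((fst w * p + a * snd w) * (snd w * q) - (fst w * q + b * snd w) * (snd w * p)) =
        snd w * snd w * (h * (a * q - b * p))" by (simp add: algebra_simps)
    with * show "loc_frac f (fst w * snd y + fst y * snd w) (snd w * snd y) =
        loc_frac f (fst w * snd z + fst z * snd w) (snd w * snd z)"
      by (subst loc_frac_eq_iff) (simp_all, intro bexI[of _ h], simp_all)
  qed (auto simp: mult.commute add.commute)
  from UN_equiv_class2[OF equiv_loc_rel equiv_loc_rel this, of "(r, g)" "(r', g')"] assms
  show ?thesis by (simp add: localization_def loc_frac_def)
qed

lemma localization_one: "\<one>\<^bsub>localization f\<^esub> = loc_frac f 1 1"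
  and localization_zero: "\<zero>\<^bsub>localization f\<^esub> = loc_frac f 0 1"
  by (simp_all add: localization_def)

lemma cring_localization: "cring (localization f)"
proof (rule cringI)
  show "abelian_group (localization f)"
  proof (rule abelian_groupI)
    fix x assume "x \<in> carrier (localization f)"
    then obtain r g where *: "g \<in> powers_of f" "x = loc_frac f r g" by (rule localization_cases)
    have "loc_frac f (-r) g \<oplus>\<^bsub>localization f\<^esub> x = \<zero>\<^bsub>localization f\<^esub>"
      unfolding * localization_zero using *(1)
      by (simp add: loc_frac_add) (rule loc_frac_eqI, simp_all)
    with * show "\<exists>y\<in>carrier (localization f). y \<oplus>\<^bsub>localization f\<^esub> x = \<zero>\<^bsub>localization f\<^esub>"
      by (intro bexI[of _ "loc_frac f (-r) g"]) auto
  next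
    fix x y z assume "x \<in> carrier (localization f)" "y \<in> carrier (localization f)"
      "z \<in> carrier (localization f)"
    then show "(x \<oplus>\<^bsub>localization f\<^esub> y) \<oplus>\<^bsub>localization f\<^esub> z =
        x \<oplus>\<^bsub>localization f\<^esub> (y \<oplus>\<^bsub>localization f\<^esub> z)"
      by (elim localization_cases) (simp add: loc_frac_add algebra_simps)
  next
    fix x y assume "x \<in> carrier (localization f)" "y \<in> carrier (localization f)"
    then show "x \<oplus>\<^bsub>localization f\<^esub> y \<in> carrier (localization f)"
      and "x \<oplus>\<^bsub>localization f\<^esub> y = y \<oplus>\<^bsub>localization f\<^esub> x"
      by (elim localization_cases, simp add: loc_frac_add algebra_simps)+
  next
    fix x assume "x \<in> carrier (localization f)"
    then show "\<zero>\<^bsub>localization f\<^esub> \<oplus>\<^bsub>localization f\<^esub> x = x"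
      by (elim localization_cases) (simp add: loc_frac_add localization_zero)
  qed (simp add: localization_zero)
  show "comm_monoid (localization f)"
  proof (rule comm_monoidI)
    fix x y z assume "x \<in> carrier (localization f)" "y \<in> carrier (localization f)"
      "z \<in> carrier (localization f)"
    then show "(x \<otimes>\<^bsub>localization f\<^esub> y) \<otimes>\<^bsub>localization f\<^esub> z =
        x \<otimes>\<^bsub>localization f\<^esub> (y \<otimes>\<^bsub>localization f\<^esub> z)"
      by (elim localization_cases) (simp add: loc_frac_mult algebra_simps)
  next
    fix x y assume "x \<in> carrier (localization f)" "y \<in> carrier (localization f)"
    then show "x \<otimes>\<^bsub>localization f\<^esub> y \<in> carrier (localization f)"
      and "x \<otimes>\<^bsub>localization f\<^esub> y = y \<otimes>\<^bsub>localization f\<^esub> x"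
      by (elim localization_cases, simp add: loc_frac_mult algebra_simps)+
  next
    fix x assume "x \<in> carrier (localization f)"
    then show "\<one>\<^bsub>localization f\<^esub> \<otimes>\<^bsub>localization f\<^esub> x = x"
      by (elim localization_cases) (simp add: loc_frac_mult localization_one)
  qed (simp add: localization_one)
next
  fix x y z assume "x \<in> carrier (localization f)" "y \<in> carrier (localization f)"
    "z \<in> carrier (localization f)"
  then obtain a p b q c r where *: "p \<in> powers_of f" "q \<in> powers_of f" "r \<in> powers_of f"
    "x = loc_frac f a p" "y = loc_frac f b q" "z = loc_frac f c r"
    by (elim localization_cases)
  then have "(x \<oplus>\<^bsub>localization f\<^esub> y) \<otimes>\<^bsub>localization f\<^esub> z = loc_frac f ((a * q + b * p) * c) (p * q * r)"
    by (simp add: loc_frac_mult loc_frac_add)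
  also have "\<dots> = loc_frac f (a * c * (q * r) + b * c * (p * r)) (p * r * (q * r))"
    using * by (intro loc_frac_eqI) (auto simp: algebra_simps)
  also have "\<dots> = x \<otimes>\<^bsub>localization f\<^esub> z \<oplus>\<^bsub>localization f\<^esub> y \<otimes>\<^bsub>localization f\<^esub> z"
    using * by (simp add: loc_frac_mult loc_frac_add)
  finally show "(x \<oplus>\<^bsub>localization f\<^esub> y) \<otimes>\<^bsub>localization f\<^esub> z =
      x \<otimes>\<^bsub>localization f\<^esub> z \<oplus>\<^bsub>localization f\<^esub> y \<otimes>\<^bsub>localization f\<^esub> z" .
qed

lemma finsum_loc_frac:
  assumes "g \<in> powers_of f"
  shows "(\<Oplus>\<^bsub>localization f\<^esub>j\<in>{..t::nat}. loc_frac f (a j) g) = loc_frac f (\<Sum>j\<le>t. a j) g"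
proof -
  interpret L: cring "localization f" by (rule cring_localization)
  show ?thesis
  proof (induction t)
    case 0
    show ?case using assms by (simp add: L.finsum_insert)
  next
    case (Suc t)
    have "(\<Oplus>\<^bsub>localization f\<^esub>j\<in>{..Suc t}. loc_frac f (a j) g) =
        loc_frac f (a (Suc t)) g \<oplus>\<^bsub>localization f\<^esub> loc_frac f (\<Sum>j\<le>t. a j) g"
      using assms Suc by (subst atMost_Suc, subst L.finsum_insert) auto
    also have "\<dots> = loc_frac f (\<Sum>j\<le>Suc t. a j) g"
      using assms by (simp add: loc_frac_add, intro loc_frac_eqI) (auto simp: algebra_simps)
    finally show ?case .
  qed
qed

definition act_num :: "nat \<Rightarrow> ('r::comm_ring_1 \<Rightarrow> 'r) \<Rightarrow> 'r \<Rightarrow> 'r \<Rightarrow> 'r" where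
  "act_num t \<delta> r g = (\<Sum>j\<le>t. (-1) ^ j * g ^ (t - j) * iter_comm j g \<delta> r)"

lemma act_frac_eq:
  assumes "g \<in> powers_of f"
  shows "act_frac f t \<delta> r g = loc_frac f (act_num t \<delta> r g) (g ^ (t + 1))"
proof -
  interpret L: cring "localization f" by (rule cring_localization)
  have "act_frac f t \<delta> r g = (\<Oplus>\<^bsub>localization f\<^esub>j\<in>{..t}.
      loc_frac f ((-1) ^ j * g ^ (t - j) * iter_comm j g \<delta> r) (g ^ (t + 1)))"
    unfolding act_frac_def
  proof (rule L.finsum_cong', goal_cases)
    case (3 j)
    then have "g ^ (t + 1) = g ^ (t - j) * g ^ (j + 1)" by (simp flip: power_add power_Suc)
    with assms show ?case by (intro loc_frac_eqI) (auto simp: mult_ac simp del: power_Suc)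
  qed (use assms in auto)
  with assms show ?thesis by (simp only: finsum_loc_frac powers_of_pow act_num_def)
qed

lemma mult_in_mult_ops: "(\<lambda>x. g * x) \<in> mult_ops"
  unfolding mult_ops_def by (auto intro!: module_hom.intro module.intro module_hom_axioms.intro simp: algebra_simps)

lemma mult_opsE:
  assumes "\<mu> \<in> mult_ops" obtains g where "\<mu> = (\<lambda>x. g * x)"
proof -
  have "\<mu> x = \<mu> 1 * x" for x
    using module_hom.scale[of "(*)" "(*)" \<mu> x 1] assms by (simp add: mult_ops_def mult.commute)
  with that show ?thesis by blast
qed

lemma diff_ops_le_0_iff: "\<delta> \<in> diff_ops_le scale 0 \<longleftrightarrow> (\<exists>g. \<delta> = (\<lambda>x. g * x))"
  by (auto elim: mult_opsE simp: mult_in_mult_ops)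

lemma diff_ops_le_Suc_iff: "\<delta> \<in> diff_ops_le scale (Suc i) \<longleftrightarrow>
    Vector_Spaces.linear scale scale \<delta> \<and> (\<forall>g. (\<lambda>x. \<delta> (g * x) - g * \<delta> x) \<in> diff_ops_le scale i)"
  by (fastforce elim: mult_opsE simp: mult_in_mult_ops)

declare diff_ops_le.simps [simp del]

lemma iter_comm_Suc_shift:
  "iter_comm (Suc j) g \<delta> = iter_comm j g (\<lambda>x. \<delta> (g * x) - g * \<delta> x)"
  by (induction j) (auto simp: fun_eq_iff)

lemma act_num_Suc:
  "act_num (Suc t) \<delta> r g = g ^ Suc t * \<delta> r - act_num t (\<lambda>x. \<delta> (g * x) - g * \<delta> x) r g"
  unfolding act_num_def
  by (subst sum.atMost_Suc_shift) (simp add: iter_comm_Suc_shift sum_negf del: iter_comm.simps(2))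

lemma iter_comm_add: "iter_comm j g (\<lambda>x. \<alpha> x + \<beta> x) r = iter_comm j g \<alpha> r + iter_comm j g \<beta> r"
  by (induction j arbitrary: r) (auto simp: algebra_simps)

lemma iter_comm_mult: "iter_comm j g (\<lambda>x. h * \<alpha> x) r = h * iter_comm j g \<alpha> r"
  by (induction j arbitrary: r) (auto simp: algebra_simps)

lemma act_num_add: "act_num t (\<lambda>x. \<alpha> x + \<beta> x) r g = act_num t \<alpha> r g + act_num t \<beta> r g"
  by (simp add: act_num_def iter_comm_add algebra_simps sum.distrib)

lemma act_num_mult: "act_num t (\<lambda>x. h * \<alpha> x) r g = h * act_num t \<alpha> r g"
  by (simp add: act_num_def iter_comm_mult sum_distrib_left algebra_simps)

lemma act_num_comp:
  "\<delta> \<in> diff_ops_le scale t \<Longrightarrow> act_num t (\<lambda>x. \<delta> (g * x)) r g = g ^ Suc t * \<delta> r"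
proof (induction t arbitrary: \<delta>)
  case 0
  then show ?case by (auto simp: diff_ops_le_0_iff act_num_def)
next
  case (Suc t)
  let ?\<epsilon> = "\<lambda>x. \<delta> (g * x) - g * \<delta> x"
  have "act_num t (\<lambda>x. \<delta> (g * (g * x)) - g * \<delta> (g * x)) r g = g ^ Suc t * (\<delta> (g * r) - g * \<delta> r)"
    using Suc.IH[of ?\<epsilon>] Suc.prems by (auto simp: diff_ops_le_Suc_iff)
  then show ?case by (simp add: act_num_Suc algebra_simps)
qed

lemma act_num_cancel:
  "\<delta> \<in> diff_ops_le scale t \<Longrightarrow> act_num t \<delta> (h * r) (h * g) = h ^ Suc t * act_num t \<delta> r g"
proof (induction t arbitrary: \<delta>)
  case 0
  then show ?case by (auto simp: diff_ops_le_0_iff act_num_def)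
next
  case (Suc t)
  have mem: "(\<lambda>x. \<delta> (k * x) - k * \<delta> x) \<in> diff_ops_le scale t" for k
    using Suc.prems by (simp add: diff_ops_le_Suc_iff)
  let ?X = "act_num t (\<lambda>x. \<delta> (g * x) - g * \<delta> x) r g"
  have "(\<lambda>x. \<delta> (h * g * x) - h * g * \<delta> x) =
      (\<lambda>x. (\<delta> (h * (g * x)) - h * \<delta> (g * x)) + h * (\<delta> (g * x) - g * \<delta> x))"
    by (simp add: fun_eq_iff algebra_simps)
  then have 1: "act_num t (\<lambda>x. \<delta> (h * g * x) - h * g * \<delta> x) r g =
      g ^ Suc t * (\<delta> (h * r) - h * \<delta> r) + h * ?X"
    using act_num_comp[OF mem[of h], of g r] by (simp only: act_num_add act_num_mult)
  have "act_num (Suc t) \<delta> (h * r) (h * g) = (h * g) ^ Suc t * \<delta> (h * r) -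
      h ^ Suc t * (g ^ Suc t * (\<delta> (h * r) - h * \<delta> r) + h * ?X)"
    by (simp only: act_num_Suc Suc.IH[OF mem[of "h * g"]] 1)
  also have "\<dots> = h ^ Suc (Suc t) * (g ^ Suc t * \<delta> r - ?X)"
    by (simp add: algebra_simps power_mult_distrib)
  finally show ?case by (simp only: act_num_Suc)
qed

lemma diff_ops_le_linear:
  assumes "comm_algebra scale" "\<delta> \<in> diff_ops_le scale t"
  shows "Vector_Spaces.linear scale scale \<delta>"
proof (cases t)
  case 0
  interpret comm_algebra scale by fact
  from 0 assms obtain g where "\<delta> = (\<lambda>x. g * x)" by (auto simp: diff_ops_le_0_iff)
  moreover have "g * scale c x = scale c (g * x)" for c x
    using scale_mult_left[of c x g] by (simp only: mult.commute)
  ultimately show ?thesis by unfold_locales (simp_all add: distrib_left)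
qed (use assms in \<open>auto simp: diff_ops_le_Suc_iff\<close>)

lemma diff_ops_le_mult:
  assumes "comm_algebra scale"
  shows "(\<lambda>x. g * x) \<in> diff_ops_le scale t"
proof (induction t arbitrary: g)
  case (Suc t)
  have "(\<lambda>x. g * x) \<in> diff_ops_le scale 0" by (auto simp: diff_ops_le_0_iff)
  then have "Vector_Spaces.linear scale scale (\<lambda>x. g * x)" by (rule diff_ops_le_linear[OF assms])
  moreover have "(\<lambda>x. g * (k * x) - k * (g * x)) = (\<lambda>x. 0 * x)" for k
    by (simp add: fun_eq_iff algebra_simps)
  then have "(\<lambda>x. g * (k * x) - k * (g * x)) \<in> diff_ops_le scale t" for k
    using Suc[of 0] by metis
  ultimately show ?case unfolding diff_ops_le_Suc_iff by blast
qed (use mult_in_mult_ops in \<open>simp add: diff_ops_le.simps\<close>)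

lemma diff_ops_le_Suc:
  assumes "comm_algebra scale"
  shows "\<delta> \<in> diff_ops_le scale t \<Longrightarrow> \<delta> \<in> diff_ops_le scale (Suc t)"
proof (induction t arbitrary: \<delta>)
  case 0
  then obtain g where "\<delta> = (\<lambda>x. g * x)" unfolding diff_ops_le_0_iff by blast
  then show ?case by (simp only: diff_ops_le_mult[OF assms])
next
  case (Suc t)
  then have *: "Vector_Spaces.linear scale scale \<delta>"
      "(\<lambda>x. \<delta> (g * x) - g * \<delta> x) \<in> diff_ops_le scale t" for g
    unfolding diff_ops_le_Suc_iff by blast+
  show ?case by (subst diff_ops_le_Suc_iff) (use *(1) Suc.IH[OF *(2)] in blast)
qed

lemma diff_ops_le_mono:
  assumes "comm_algebra scale" "t \<le> t'"
  shows "diff_ops_le scale t \<subseteq> diff_ops_le scale t'"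
  by (rule lift_Suc_mono_le[OF _ assms(2)]) (use diff_ops_le_Suc[OF assms(1)] in blast)

lemma iter_comm_eq_0: "\<delta> \<in> diff_ops_le scale t \<Longrightarrow> iter_comm (Suc t) g \<delta> = (\<lambda>_. 0)"
proof (induction t arbitrary: \<delta>)
  case (Suc t)
  then show ?case
    by (subst iter_comm_Suc_shift) (auto simp: diff_ops_le_Suc_iff simp del: iter_comm.simps)
qed (auto simp: diff_ops_le_0_iff algebra_simps)

lemma act_frac_Suc:
  assumes "\<delta> \<in> diff_ops_le scale t" "g \<in> powers_of f"
  shows "act_frac f (Suc t) \<delta> r g = act_frac f t \<delta> r g"
proof -
  have "act_num (Suc t) \<delta> r g = g * act_num t \<delta> r g"
    using iter_comm_eq_0[OF assms(1), of g]
    by (simp add: act_num_def sum_distrib_left Suc_diff_le algebra_simps del: iter_comm.simps)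
  then show ?thesis
    using assms(2) by (simp add: act_frac_eq, intro loc_frac_eqI) (auto simp: algebra_simps)
qed

lemma act_frac_order:
  assumes "comm_algebra scale" "\<delta> \<in> diff_ops_le scale t" "g \<in> powers_of f" "t \<le> t'"
  shows "act_frac f t' \<delta> r g = act_frac f t \<delta> r g"
  using assms(4)
proof (induction rule: dec_induct)
  case (step m)
  then have "\<delta> \<in> diff_ops_le scale m" using diff_ops_le_mono[OF assms(1)] assms(2) by blast
  with step show ?case using act_frac_Suc assms(3) by metis
qed simp

lemma act_frac_cancel:
  assumes "\<delta> \<in> diff_ops_le scale t" "g \<in> powers_of f" "h \<in> powers_of f"
  shows "act_frac f t \<delta> (h * r) (h * g) = act_frac f t \<delta> r g"
  using assms act_num_cancel[OF assms(1), of h r g]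
  by (simp add: act_frac_eq, intro loc_frac_eqI) (auto simp: algebra_simps power_mult_distrib)

lemma act_frac_cong:
  assumes "\<delta> \<in> diff_ops_le scale t" "g \<in> powers_of f" "g' \<in> powers_of f"
    and "loc_frac f r g = loc_frac f r' g'"
  shows "act_frac f t \<delta> r g = act_frac f t \<delta> r' g'"
proof -
  from assms obtain h where h: "h \<in> powers_of f" "h * (r * g' - r' * g) = 0"
    by (auto simp: loc_frac_eq_iff)
  have "act_frac f t \<delta> r g = act_frac f t \<delta> ((h * g') * r) ((h * g') * g)"
    using assms h by (intro act_frac_cancel[symmetric]) auto
  also have "(h * g') * r = (h * g) * r'" using h(2) by (simp add: algebra_simps)
  also have "(h * g') * g = (h * g) * g'" by (simp add: algebra_simps)
  also have "act_frac f t \<delta> ((h * g) * r') ((h * g) * g') = act_frac f t \<delta> r' g'"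
    using assms h by (intro act_frac_cancel) auto
  finally show ?thesis .
qed

lemma loc_act_frac:
  assumes alg: "comm_algebra scale" and \<delta>: "\<delta> \<in> diff_ops_le scale t" and g: "g \<in> powers_of f"
  shows "loc_act scale f \<delta> (loc_frac f r g) = act_frac f t \<delta> r g"
  unfolding loc_act_def
proof (rule the_equality)
  fix v assume "\<exists>t' r' g'. \<delta> \<in> diff_ops_le scale t' \<and> g' \<in> powers_of f \<and>
      loc_frac f r g = loc_frac f r' g' \<and> v = act_frac f t' \<delta> r' g'"
  then obtain t' r' g' where *: "\<delta> \<in> diff_ops_le scale t'" "g' \<in> powers_of f"
    "loc_frac f r g = loc_frac f r' g'" "v = act_frac f t' \<delta> r' g'" by blast
  have "v = act_frac f t' \<delta> r g" using * act_frac_cong[OF *(1) g *(2,3)] by simp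
  also have "\<dots> = act_frac f (max t t') \<delta> r g"
    using act_frac_order[OF alg *(1) g, of "max t t'"] by simp
  also have "\<dots> = act_frac f t \<delta> r g" using act_frac_order[OF alg \<delta> g, of "max t t'"] by simp
  finally show "v = act_frac f t \<delta> r g" .
qed (use assms in blast)

lemma diff_ops_le_add:
  assumes "comm_algebra scale"
  shows "\<alpha> \<in> diff_ops_le scale t \<Longrightarrow> \<beta> \<in> diff_ops_le scale t \<Longrightarrow> (\<lambda>x. \<alpha> x + \<beta> x) \<in> diff_ops_le scale t"
proof (induction t arbitrary: \<alpha> \<beta>)
  case 0
  then obtain a b where "\<alpha> = (\<lambda>x. a * x)" "\<beta> = (\<lambda>x. b * x)" by (auto simp: diff_ops_le_0_iff)
  then show ?case by (auto simp: diff_ops_le_0_iff fun_eq_iff algebra_simps intro!: exI[of _ "a + b"])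
next
  case (Suc t)
  interpret comm_algebra scale by fact
  interpret vector_space_pair scale scale ..
  have "(\<lambda>x. (\<alpha> (g * x) - g * \<alpha> x) + (\<beta> (g * x) - g * \<beta> x)) \<in> diff_ops_le scale t" for g
    using Suc by (auto simp: diff_ops_le_Suc_iff)
  then show ?case using Suc.prems by (auto simp: diff_ops_le_Suc_iff algebra_simps linear_compose_add)
qed

lemma diff_ops_le_scale:
  assumes "comm_algebra scale"
  shows "\<alpha> \<in> diff_ops_le scale t \<Longrightarrow> (\<lambda>x. scale c (\<alpha> x)) \<in> diff_ops_le scale t"
proof (induction t arbitrary: \<alpha>)
  case 0
  interpret comm_algebra scale by fact
  from 0 obtain a where "\<alpha> = (\<lambda>x. a * x)" by (auto simp: diff_ops_le_0_iff)
  then show ?case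
    by (auto simp: diff_ops_le_0_iff fun_eq_iff scale_mult_left intro!: exI[of _ "scale c a"])
next
  case (Suc t)
  interpret comm_algebra scale by fact
  interpret vector_space_pair scale scale ..
  have "(\<lambda>x. scale c (\<alpha> (g * x) - g * \<alpha> x)) \<in> diff_ops_le scale t" for g
    using Suc by (auto simp: diff_ops_le_Suc_iff)
  moreover have "scale c (\<alpha> (g * x) - g * \<alpha> x) = scale c (\<alpha> (g * x)) - g * scale c (\<alpha> x)" for g x
    using scale_mult_left[of c "\<alpha> x" g] by (simp add: scale_right_diff_distrib mult.commute)
  ultimately show ?case
    using Suc.prems by (auto simp: diff_ops_le_Suc_iff linear_compose_scale_right)
qed

lemma diff_ops_0:
  assumes "comm_algebra scale" shows "(\<lambda>_. 0) \<in> diff_ops scale"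
  using diff_ops_le_mult[OF assms, of 0] by (auto simp: diff_ops_def)

lemma diff_ops_add:
  assumes "comm_algebra scale" "\<alpha> \<in> diff_ops scale" "\<beta> \<in> diff_ops scale"
  shows "(\<lambda>x. \<alpha> x + \<beta> x) \<in> diff_ops scale"
proof -
  from assms obtain i j where "\<alpha> \<in> diff_ops_le scale i" "\<beta> \<in> diff_ops_le scale j"
    by (auto simp: diff_ops_def)
  then have "\<alpha> \<in> diff_ops_le scale (max i j)" "\<beta> \<in> diff_ops_le scale (max i j)"
    using diff_ops_le_mono[OF assms(1)] by (meson max.cobounded1 max.cobounded2 subsetD)+
  then show ?thesis using diff_ops_le_add[OF assms(1)] by (auto simp: diff_ops_def)
qed

lemma diff_ops_scale:
  assumes "comm_algebra scale" "\<alpha> \<in> diff_ops scale"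
  shows "(\<lambda>x. scale c (\<alpha> x)) \<in> diff_ops scale"
  using assms(2) diff_ops_le_scale[OF assms(1)] unfolding diff_ops_def by blast

lemma eval_op_poly_eq:
  assumes "comm_algebra scale" "finite S" "\<And>i. i \<notin> S \<Longrightarrow> P i = (\<lambda>_. 0)"
  shows "eval_op_poly scale P a x = (\<Sum>i\<in>S. scale (a ^ i) (P i x))"
proof -
  interpret comm_algebra scale by fact
  show ?thesis unfolding eval_op_poly_def using assms(2,3) by (intro sum.mono_neutral_left) auto
qed

lemma bernstein_sato_ideal_iff:
  assumes "comm_algebra scale"
  shows "b \<in> bernstein_sato_ideal scale f \<longleftrightarrow>
    (\<exists>P d. (\<forall>i. P i \<in> diff_ops scale) \<and> (\<forall>i>d. P i = (\<lambda>_. 0)) \<and>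
      (\<forall>m::nat. (\<Sum>i\<le>d. scale (of_nat m ^ i) (P i (f ^ (m + 1)))) = scale (poly b (of_nat m)) (f ^ m)))"
    (is "_ \<longleftrightarrow> ?rhs")
proof
  assume "b \<in> bernstein_sato_ideal scale f"
  then obtain P where P: "P \<in> diff_op_polys scale" "\<And>m::nat.
      eval_op_poly scale P (of_nat m) (f ^ (m + 1)) = scale (poly b (of_nat m)) (f ^ m)"
    by (auto simp: bernstein_sato_ideal_def)
  then obtain d where "\<forall>i\<in>{i. P i \<noteq> (\<lambda>_. 0)}. i \<le> d"
    unfolding diff_op_polys_def using finite_nat_set_iff_bounded_le by auto
  then have d: "\<forall>i>d. P i = (\<lambda>_. 0)" by (meson linorder_not_le mem_Collect_eq)
  have "eval_op_poly scale P a x = (\<Sum>i\<le>d. scale (a ^ i) (P i x))" for a x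
    using d by (intro eval_op_poly_eq[OF assms]) auto
  with P d show ?rhs
    by (intro exI[of _ P] exI[of _ d]) (auto simp: diff_op_polys_def)
next
  assume ?rhs
  then obtain P d where P: "\<forall>i. P i \<in> diff_ops scale" "\<forall>i>d. P i = (\<lambda>_. 0)"
    "\<forall>m::nat. (\<Sum>i\<le>d. scale (of_nat m ^ i) (P i (f ^ (m + 1)))) = scale (poly b (of_nat m)) (f ^ m)"
    by blast
  have "{i. P i \<noteq> (\<lambda>_. 0)} \<subseteq> {..d}" using P(2) by (auto simp flip: not_less)
  then have "P \<in> diff_op_polys scale"
    using P(1) by (auto simp: diff_op_polys_def finite_subset)
  moreover have "eval_op_poly scale P a x = (\<Sum>i\<le>d. scale (a ^ i) (P i x))" for a x
    using P(2) by (intro eval_op_poly_eq[OF assms]) auto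
  ultimately show "b \<in> bernstein_sato_ideal scale f"
    using P(3) unfolding bernstein_sato_ideal_def by (intro CollectI bexI[of _ P]) simp_all
qed

lemma bernstein_sato_ideal_add:
  assumes alg: "comm_algebra scale"
    and "b \<in> bernstein_sato_ideal scale f" "c \<in> bernstein_sato_ideal scale f"
  shows "b + c \<in> bernstein_sato_ideal scale f"
proof -
  interpret comm_algebra scale by fact
  from assms obtain P d Q e where P: "\<forall>i. P i \<in> diff_ops scale" "\<forall>i>d. P i = (\<lambda>_. 0)"
      "\<And>m::nat. (\<Sum>i\<le>d. scale (of_nat m ^ i) (P i (f ^ (m + 1)))) = scale (poly b (of_nat m)) (f ^ m)"
    and Q: "\<forall>i. Q i \<in> diff_ops scale" "\<forall>i>e. Q i = (\<lambda>_. 0)"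
      "\<And>m::nat. (\<Sum>i\<le>e. scale (of_nat m ^ i) (Q i (f ^ (m + 1)))) = scale (poly c (of_nat m)) (f ^ m)"
    by (simp only: bernstein_sato_ideal_iff[OF alg]) blast
  let ?d = "max d e"
  have 1: "(\<Sum>i\<le>?d. scale (of_nat m ^ i) (P i (f ^ (m + 1)))) = scale (poly b (of_nat m)) (f ^ m)" for m
    unfolding P(3)[symmetric] using P(2) by (intro sum.mono_neutral_right) auto
  have 2: "(\<Sum>i\<le>?d. scale (of_nat m ^ i) (Q i (f ^ (m + 1)))) = scale (poly c (of_nat m)) (f ^ m)" for m
    unfolding Q(3)[symmetric] using Q(2) by (intro sum.mono_neutral_right) auto
  show ?thesis
    unfolding bernstein_sato_ideal_iff[OF alg]
    using P(1,2) Q(1,2) 1 2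
    by (intro exI[of _ "\<lambda>i x. P i x + Q i x"] exI[of _ ?d])
      (auto simp: diff_ops_add[OF alg] scale_right_distrib scale_left_distrib sum.distrib)
qed

lemma bernstein_sato_ideal_smult:
  assumes alg: "comm_algebra scale" and "b \<in> bernstein_sato_ideal scale f"
  shows "smult c b \<in> bernstein_sato_ideal scale f"
proof -
  interpret comm_algebra scale by fact
  from assms obtain P d where P: "\<forall>i. P i \<in> diff_ops scale" "\<forall>i>d. P i = (\<lambda>_. 0)"
      "\<And>m::nat. (\<Sum>i\<le>d. scale (of_nat m ^ i) (P i (f ^ (m + 1)))) = scale (poly b (of_nat m)) (f ^ m)"
    by (simp only: bernstein_sato_ideal_iff[OF alg]) blast
  have "(\<Sum>i\<le>d. scale (of_nat m ^ i) (scale c (P i (f ^ (m + 1))))) =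
      scale (poly (smult c b) (of_nat m)) (f ^ m)" for m
    using arg_cong[OF P(3)[of m], of "scale c"] by (simp add: scale_sum_right mult.commute)
  with P(1,2) show ?thesis
    unfolding bernstein_sato_ideal_iff[OF alg]
    by (intro exI[of _ "\<lambda>i x. scale c (P i x)"] exI[of _ d]) (auto simp: diff_ops_scale[OF alg])
qed

lemma bernstein_sato_ideal_pCons:
  assumes alg: "comm_algebra scale" and "b \<in> bernstein_sato_ideal scale f"
  shows "pCons 0 b \<in> bernstein_sato_ideal scale f"
proof -
  interpret comm_algebra scale by fact
  from assms obtain P d where P: "\<forall>i. P i \<in> diff_ops scale" "\<forall>i>d. P i = (\<lambda>_. 0)"
      "\<And>m::nat. (\<Sum>i\<le>d. scale (of_nat m ^ i) (P i (f ^ (m + 1)))) = scale (poly b (of_nat m)) (f ^ m)"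
    by (simp only: bernstein_sato_ideal_iff[OF alg]) blast
  let ?Q = "\<lambda>i. case i of 0 \<Rightarrow> (\<lambda>_. 0) | Suc j \<Rightarrow> P j"
  have "(\<Sum>i\<le>Suc d. scale (of_nat m ^ i) (?Q i (f ^ (m + 1)))) =
      scale (poly (pCons 0 b) (of_nat m)) (f ^ m)" for m
    using arg_cong[OF P(3)[of m], of "scale (of_nat m)"]
    by (subst sum.atMost_Suc_shift) (simp add: scale_sum_right)
  moreover have "?Q i \<in> diff_ops scale" for i using P(1) diff_ops_0[OF alg] by (cases i) auto
  moreover have "?Q i = (\<lambda>_. 0)" if "i > Suc d" for i using P(2) that by (cases i) auto
  ultimately show ?thesis unfolding bernstein_sato_ideal_iff[OF alg] by blast
qed

lemma bernstein_sato_ideal_mult: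
  assumes alg: "comm_algebra scale" and b: "b \<in> bernstein_sato_ideal scale f"
  shows "p * b \<in> bernstein_sato_ideal scale f"
proof (induction p)
  case 0
  then show ?case using bernstein_sato_ideal_smult[OF alg b, of 0] by simp
next
  case (pCons a p)
  then show ?case
    using bernstein_sato_ideal_add[OF alg bernstein_sato_ideal_smult[OF alg b]
        bernstein_sato_ideal_pCons[OF alg pCons(2)]] by simp
qed

lemma bernstein_sato_poly_generates:
  assumes alg: "comm_algebra scale" and "has_bernstein_sato_poly scale f"
  shows "lead_coeff (bernstein_sato_poly scale f) = 1 \<and>
    bernstein_sato_ideal scale f = {p. bernstein_sato_poly scale f dvd p}"
proof -
  let ?I = "bernstein_sato_ideal scale f"
  from assms(2) have "\<exists>b. b \<in> ?I \<and> b \<noteq> 0" by (auto simp: has_bernstein_sato_poly_def)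
  from this ex_has_least_nat[of "\<lambda>b. b \<in> ?I \<and> b \<noteq> 0" _ degree]
  obtain b where b: "b \<in> ?I" "b \<noteq> 0" "\<And>c. c \<in> ?I \<Longrightarrow> c \<noteq> 0 \<Longrightarrow> degree b \<le> degree c"
    by metis
  have "b dvd p" if "p \<in> ?I" for p
  proof -
    have "p + (- (p div b)) * b \<in> ?I"
      by (intro bernstein_sato_ideal_add bernstein_sato_ideal_mult alg that b)
    then have "p mod b \<in> ?I" by (simp add: minus_div_mult_eq_mod)
    then have "p mod b = 0" using b(3)[of "p mod b"] degree_mod_less[OF b(2), of p] by force
    then show ?thesis by (simp add: mod_eq_0_iff_dvd)
  qed
  then have I: "?I = {p. b dvd p}"
    using bernstein_sato_ideal_mult[OF alg b(1)] by (auto simp: dvd_def mult.commute)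
  let ?c = "smult (inverse (lead_coeff b)) b"
  have c: "lead_coeff ?c = 1 \<and> ?I = {p. ?c dvd p}"
    using b(2) by (simp add: I smult_dvd_iff)
  show ?thesis
    unfolding bernstein_sato_poly_def
  proof (rule theI[where P = "\<lambda>b. lead_coeff b = 1 \<and> ?I = {p. b dvd p}", OF c])
    fix c' assume c': "lead_coeff c' = 1 \<and> ?I = {p. c' dvd p}"
    with c have "c' dvd ?c" "?c dvd c'" by auto
    moreover have "?c \<noteq> 0" "c' \<noteq> 0" using c c' by auto
    ultimately have deg: "degree c' = degree ?c" by (intro antisym dvd_imp_degree_le)
    from \<open>c' dvd ?c\<close> obtain k where k: "?c = c' * k" by (rule dvdE)
    with \<open>?c \<noteq> 0\<close> have "c' \<noteq> 0" "k \<noteq> 0" by auto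
    with deg k have "degree k = 0" by (simp add: degree_mult_eq)
    moreover have "lead_coeff k = 1"
      using c c' lead_coeff_mult[of c' k] unfolding k[symmetric] by simp
    ultimately have "k = 1" by (metis one_pCons degree_eq_zeroE coeff_pCons_0)
    with k show "c' = ?c" by simp
  qed
qed

end

theory Submission
  imports Defs
begin

text \<open>
  Write \<open>b\<close> for the Bernstein-Sato polynomial of \<open>f\<close> and \<open>b(s) = (s + n) c(s)\<close>, and suppose that an
  operator \<open>\<delta>\<close> of order at most \<open>t\<close> maps \<open>1/f^(n-1)\<close> to \<open>1/f^n\<close>.  The action of \<open>\<delta>\<close> on powers of \<open>f\<close> is
  polynomial in the exponent: there is one polynomial \<open>T\<close> in \<open>a\<close>, with coefficients in \<open>R\<close>, such
  that \<open>\<delta> f^a = f^(a-t) T(a)\<close> for natural \<open>a \<ge> t\<close> (\<open>apply_to_power\<close>) and,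
  in the localization, for negative \<open>a\<close> (\<open>act_on_inverse_power\<close>).  The assumption on \<open>\<delta>\<close> therefore says
  \<open>f^(t-1) = T(1 - n)\<close> up to torsion, and since \<open>s + n\<close> divides \<open>T(s + 1) - T(1 - n)\<close>, there is a \<open>Q\<close> with
  \<open>\<delta> f^(s+1) = f^s + (s + n) Q(s) f \<cdot> f^(s-t)\<close>.
  The functional equation for \<open>b\<close>, used \<open>t\<close> times, turns \<open>B(s) f^(s-t)\<close> with \<open>B(s) = b(s - 1) \<cdots> b(s - t)\<close>
  into an operator applied to \<open>f^s\<close> (\<open>iterated_functional_equation\<close>).  After multiplication by
  \<open>c(s) B(s)\<close> the error term thus becomes an operator applied to \<open>b(s) f^s\<close>, and this is an operator
  applied to \<open>f^(s+1)\<close>.  So \<open>c(s) B(s)\<close> satisfies a functional equation too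
  (\<open>bernstein_sato_ideal_reduced\<close>) and must be a multiple of \<open>b\<close>.  But \<open>-n\<close> is the smallest integral
  root of \<open>b\<close>, hence no root of \<open>B\<close>, and its multiplicity in \<open>c B\<close> is one less than in \<open>b\<close>: a contradiction.

  As \<open>f\<close> may be a zero divisor, an identity in the localization yields one in the ring only after
  multiplication by a power of \<open>f\<close>, so the functional equation for \<open>c B\<close> is obtained only for
  all exponents \<open>s \<ge> N\<close>.  The additional factor \<open>s (s - 1) \<cdots> (s - N + 1)\<close> makes it hold for every
  natural \<open>s\<close>; its roots are natural numbers and, in characteristic zero, different from \<open>-n\<close>.
\<close>

section \<open>Composition of differential operators\<close>

context comm_algebra
begin

lemma diff_ops_le_mult_comp:
  "\<beta> \<in> diff_ops_le scale j \<Longrightarrow> (\<lambda>x. h * \<beta> x) \<in> diff_ops_le scale j"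
proof (induction j arbitrary: \<beta>)
  case 0
  then obtain b where "\<beta> = (\<lambda>x. b * x)" by (auto simp: diff_ops_le_0_iff)
  then show ?case by (auto simp: diff_ops_le_0_iff fun_eq_iff mult.assoc intro!: exI[of _ "h * b"])
next
  case (Suc j)
  have lin: "Vector_Spaces.linear scale scale (\<lambda>x. h * \<beta> x)"
    using Vector_Spaces.linear_compose[OF diff_ops_le_linear[OF comm_algebra_axioms Suc.prems]
        diff_ops_le_linear[OF comm_algebra_axioms diff_ops_le_mult[OF comm_algebra_axioms, of h 0]]]
    by (simp add: o_def)
  have "(\<lambda>x. h * \<beta> (g * x) - g * (h * \<beta> x)) = (\<lambda>x. h * (\<beta> (g * x) - g * \<beta> x))" for g
    by (simp add: fun_eq_iff algebra_simps)
  moreover have "(\<lambda>x. \<beta> (g * x) - g * \<beta> x) \<in> diff_ops_le scale j" for g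
    using Suc.prems by (auto simp: diff_ops_le_Suc_iff)
  ultimately show ?case using lin Suc.IH by (auto simp: diff_ops_le_Suc_iff)
qed

text \<open>
  The Leibniz rule \<open>[\<alpha>\<beta>, g] = \<alpha>[\<beta>, g] + [\<alpha>, g]\<beta>\<close> lowers the sum of the two orders.
\<close>

lemma diff_ops_le_comp:
  "\<alpha> \<in> diff_ops_le scale i \<Longrightarrow> \<beta> \<in> diff_ops_le scale j \<Longrightarrow>
    (\<lambda>x. \<alpha> (\<beta> x)) \<in> diff_ops_le scale (i + j)"
proof (induction i arbitrary: \<alpha> \<beta> j)
  case 0
  then obtain a where "\<alpha> = (\<lambda>x. a * x)" by (auto simp: diff_ops_le_0_iff)
  with 0 show ?case using diff_ops_le_mult_comp by simp
next
  case (Suc i)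
  note outer = Suc.IH
  have \<alpha>: "(\<lambda>x. \<alpha> (g * x) - g * \<alpha> x) \<in> diff_ops_le scale i" for g
    using Suc.prems(1) by (auto simp: diff_ops_le_Suc_iff)
  have lin: "Vector_Spaces.linear scale scale (\<lambda>x. \<alpha> (\<beta> x))" if "\<beta> \<in> diff_ops_le scale j" for \<beta> j
    using Vector_Spaces.linear_compose[OF diff_ops_le_linear[OF comm_algebra_axioms that]
        diff_ops_le_linear[OF comm_algebra_axioms Suc.prems(1)]] by (simp add: o_def)
  interpret A: Vector_Spaces.linear scale scale \<alpha>
    using diff_ops_le_linear[OF comm_algebra_axioms Suc.prems(1)] .
  from Suc.prems(2) show ?case
  proof (induction j arbitrary: \<beta>)
    case 0
    then obtain b where b: "\<beta> = (\<lambda>x. b * x)" by (auto simp: diff_ops_le_0_iff)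
    have "(\<lambda>x. \<alpha> (\<beta> (g * x)) - g * \<alpha> (\<beta> x)) \<in> diff_ops_le scale i" for g
      using outer[OF \<alpha>[of g] 0] by (simp add: b mult.left_commute)
    then show ?case using lin[OF 0] by (simp add: diff_ops_le_Suc_iff)
  next
    case (Suc j)
    have "(\<lambda>x. \<alpha> (\<beta> (g * x)) - g * \<alpha> (\<beta> x)) \<in> diff_ops_le scale (i + Suc j)" for g
    proof -
      have "(\<lambda>x. \<beta> (g * x) - g * \<beta> x) \<in> diff_ops_le scale j"
        using Suc.prems by (auto simp: diff_ops_le_Suc_iff)
      then have "(\<lambda>x. \<alpha> (\<beta> (g * x) - g * \<beta> x)) \<in> diff_ops_le scale (i + Suc j)"
        using Suc.IH by simp
      from diff_ops_le_add[OF comm_algebra_axioms this outer[OF \<alpha>[of g] Suc.prems]]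
      show ?thesis by (simp add: A.diff)
    qed
    then show ?case using lin[OF Suc.prems] by (simp add: diff_ops_le_Suc_iff)
  qed
qed

lemma diff_ops_comp:
  "\<alpha> \<in> diff_ops scale \<Longrightarrow> \<beta> \<in> diff_ops scale \<Longrightarrow> (\<lambda>x. \<alpha> (\<beta> x)) \<in> diff_ops scale"
  using diff_ops_le_comp unfolding diff_ops_def by blast

lemma diff_ops_mult: "(\<lambda>x. g * x) \<in> diff_ops scale"
  using diff_ops_le_mult[OF comm_algebra_axioms] unfolding diff_ops_def by blast

lemma diff_ops_linear: "\<delta> \<in> diff_ops scale \<Longrightarrow> Vector_Spaces.linear scale scale \<delta>"
  using diff_ops_le_linear[OF comm_algebra_axioms] unfolding diff_ops_def by blast

lemma scale_mult_right: "x * scale a y = scale a (x * y)"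
  using scale_mult_left[of a y x] by (simp only: mult.commute)


section \<open>Polynomial families of differential operators\<close>

text \<open>
  The evaluation maps \<open>a \<mapsto> P(a)\<close> of the elements \<open>P\<close> of \<open>D[s]\<close>.  Generating them by constants, sums
  and multiplication by \<open>s\<close> makes it easy to see that substituting \<open>s + c\<close> for \<open>s\<close> and multiplying in
  \<open>D[s]\<close> stay inside, without any manipulation of coefficients.
\<close>

inductive_set op_families :: "('k \<Rightarrow> 'r \<Rightarrow> 'r) set" where
  const: "\<delta> \<in> diff_ops scale \<Longrightarrow> (\<lambda>_. \<delta>) \<in> op_families"
| add: "F \<in> op_families \<Longrightarrow> G \<in> op_families \<Longrightarrow> (\<lambda>a x. F a x + G a x) \<in> op_families"
| times_s: "F \<in> op_families \<Longrightarrow> (\<lambda>a x. scale a (F a x)) \<in> op_families"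

lemma op_families_linear: "F \<in> op_families \<Longrightarrow> Vector_Spaces.linear scale scale (F a)"
proof (induction rule: op_families.induct)
  case (const \<delta>)
  then show ?case by (rule diff_ops_linear)
next
  case (add F G)
  interpret vector_space_pair scale scale ..
  from add show ?case using linear_compose_add by blast
next
  case (times_s F)
  interpret vector_space_pair scale scale ..
  from times_s show ?case using linear_compose_scale_right by blast
qed

lemma op_families_scale: "F \<in> op_families \<Longrightarrow> (\<lambda>a x. scale c (F a x)) \<in> op_families"
proof (induction rule: op_families.induct)
  case (const \<delta>)
  then show ?case
    using op_families.const diff_ops_scale[OF comm_algebra_axioms] by blast
next
  case (add F G)
  from op_families.add[OF add.IH] show ?case by (simp add: scale_right_distrib)
next
  case (times_s F)
  from op_families.times_s[OF times_s.IH] show ?case by (simp add: mult.commute)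
qed

lemma op_families_poly: "F \<in> op_families \<Longrightarrow> (\<lambda>a x. scale (poly p a) (F a x)) \<in> op_families"
proof (induction p)
  case 0
  then show ?case using op_families.const[OF diff_ops_0[OF comm_algebra_axioms]] by simp
next
  case (pCons c p)
  from op_families.add[OF op_families_scale[OF pCons.prems, of c]
      op_families.times_s[OF pCons.IH[OF pCons.prems]]]
  show ?case by (simp add: scale_left_distrib)
qed

lemma op_families_diff:
  assumes "F \<in> op_families" "G \<in> op_families"
  shows "(\<lambda>a x. F a x - G a x) \<in> op_families"
  using op_families.add[OF assms(1) op_families_scale[OF assms(2), of "-1"]] by simp

lemma op_families_sum:
  assumes "finite I" "\<And>i. i \<in> I \<Longrightarrow> F i \<in> op_families"
  shows "(\<lambda>a x. \<Sum>i\<in>I. F i a x) \<in> op_families"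
  using assms
proof (induction I rule: finite_induct)
  case empty
  then show ?case using op_families.const[OF diff_ops_0[OF comm_algebra_axioms]] by simp
next
  case (insert i I)
  then have "F i \<in> op_families" "(\<lambda>a x. \<Sum>i\<in>I. F i a x) \<in> op_families" by auto
  from op_families.add[OF this] show ?case using insert.hyps by simp
qed

lemma op_families_comp_const:
  assumes "\<delta> \<in> diff_ops scale"
  shows "G \<in> op_families \<Longrightarrow> (\<lambda>a x. \<delta> (G a x)) \<in> op_families"
proof (induction rule: op_families.induct)
  case (const \<epsilon>)
  then show ?case using assms diff_ops_comp op_families.const by blast
next
  case (add F G)
  interpret L: Vector_Spaces.linear scale scale \<delta> using diff_ops_linear[OF assms] .
  from op_families.add[OF add.IH] show ?case by (simp add: L.add)
next
  case (times_s F)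
  interpret L: Vector_Spaces.linear scale scale \<delta> using diff_ops_linear[OF assms] .
  from op_families.times_s[OF times_s.IH] show ?case by (simp add: L.scale)
qed

lemma op_families_comp:
  assumes "G \<in> op_families"
  shows "F \<in> op_families \<Longrightarrow> (\<lambda>a x. F a (G a x)) \<in> op_families"
proof (induction rule: op_families.induct)
  case (const \<delta>)
  then show ?case using assms by (rule op_families_comp_const)
qed (auto intro: op_families.intros)

lemma op_families_translate: "F \<in> op_families \<Longrightarrow> (\<lambda>a. F (a + c)) \<in> op_families"
proof (induction rule: op_families.induct)
  case (times_s F)
  from op_families.add[OF op_families.times_s[OF times_s.IH] op_families_scale[OF times_s.IH, of c]]
  show ?case by (simp add: scale_left_distrib)
qed (auto intro: op_families.intros)

lemma op_families_normal_form:
  "F \<in> op_families \<Longrightarrow> \<exists>P d. (\<forall>i. P i \<in> diff_ops scale) \<and> (\<forall>i>d. P i = (\<lambda>_. 0)) \<and>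
    F = (\<lambda>a x. \<Sum>i\<le>d. scale (a ^ i) (P i x))"
proof (induction rule: op_families.induct)
  case (const \<delta>)
  then show ?case using diff_ops_0[OF comm_algebra_axioms]
    by (intro exI[of _ "\<lambda>i. if i = 0 then \<delta> else (\<lambda>_. 0)"] exI[of _ 0]) auto
next
  case (add F G)
  then obtain P d Q e where P: "\<forall>i. P i \<in> diff_ops scale" "\<forall>i>d. P i = (\<lambda>_. 0)"
      "F = (\<lambda>a x. \<Sum>i\<le>d. scale (a ^ i) (P i x))"
    and Q: "\<forall>i. Q i \<in> diff_ops scale" "\<forall>i>e. Q i = (\<lambda>_. 0)"
      "G = (\<lambda>a x. \<Sum>i\<le>e. scale (a ^ i) (Q i x))" by blast
  let ?d = "max d e"
  have 1: "F = (\<lambda>a x. \<Sum>i\<le>?d. scale (a ^ i) (P i x))"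
    unfolding P(3) using P(2) by (intro ext sum.mono_neutral_left) auto
  have 2: "G = (\<lambda>a x. \<Sum>i\<le>?d. scale (a ^ i) (Q i x))"
    unfolding Q(3) using Q(2) by (intro ext sum.mono_neutral_left) auto
  show ?case using P(1,2) Q(1,2) diff_ops_add[OF comm_algebra_axioms] unfolding 1 2
    by (intro exI[of _ "\<lambda>i x. P i x + Q i x"] exI[of _ ?d])
      (auto simp: scale_right_distrib sum.distrib)
next
  case (times_s F)
  then obtain P d where P: "\<forall>i. P i \<in> diff_ops scale" "\<forall>i>d. P i = (\<lambda>_. 0)"
      "F = (\<lambda>a x. \<Sum>i\<le>d. scale (a ^ i) (P i x))" by blast
  let ?Q = "\<lambda>i. case i of 0 \<Rightarrow> (\<lambda>_. 0) | Suc j \<Rightarrow> P j"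
  have "(\<lambda>a x. scale a (F a x)) = (\<lambda>a x. \<Sum>i\<le>Suc d. scale (a ^ i) (?Q i x))"
    unfolding P(3) by (subst sum.atMost_Suc_shift) (simp add: scale_sum_right)
  moreover have "?Q i \<in> diff_ops scale" for i
    using P(1) diff_ops_0[OF comm_algebra_axioms] by (cases i) auto
  moreover have "?Q i = (\<lambda>_. 0)" if "i > Suc d" for i using P(2) that by (cases i) auto
  ultimately show ?case by blast
qed

lemma bernstein_sato_ideal_iff_family:
  "b \<in> bernstein_sato_ideal scale f \<longleftrightarrow>
    (\<exists>F\<in>op_families. \<forall>m::nat. F (of_nat m) (f ^ (m + 1)) = scale (poly b (of_nat m)) (f ^ m))"
proof
  assume "b \<in> bernstein_sato_ideal scale f"
  then obtain P d where P: "\<forall>i. P i \<in> diff_ops scale"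
    "\<And>m::nat. (\<Sum>i\<le>d. scale (of_nat m ^ i) (P i (f ^ (m + 1)))) = scale (poly b (of_nat m)) (f ^ m)"
    by (simp only: bernstein_sato_ideal_iff[OF comm_algebra_axioms]) blast
  have "(\<lambda>a x. scale (poly (monom 1 i) a) (P i x)) \<in> op_families" for i
    using op_families_poly[OF op_families.const] P(1) by blast
  then have "(\<lambda>a x. \<Sum>i\<le>d. scale (a ^ i) (P i x)) \<in> op_families"
    by (intro op_families_sum) (auto simp: poly_monom)
  from bexI[OF _ this]
  show "\<exists>F\<in>op_families. \<forall>m::nat. F (of_nat m) (f ^ (m + 1)) = scale (poly b (of_nat m)) (f ^ m)"
    using P(2) by simp
next
  assume "\<exists>F\<in>op_families. \<forall>m::nat.
    F (of_nat m) (f ^ (m + 1)) = scale (poly b (of_nat m)) (f ^ m)"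
  then show "b \<in> bernstein_sato_ideal scale f"
    using op_families_normal_form unfolding bernstein_sato_ideal_iff[OF comm_algebra_axioms] by fast
qed

text \<open>
  Substituting \<open>s - i\<close> for \<open>s\<close> in \<open>G(s) f^(s+1) = b(s) f^s\<close>, the operators \<open>G(s - 1), \<dots>, G(s - k)\<close> applied in
  this order lower the exponent \<open>s\<close> step by step to \<open>s - k\<close>.  The restriction to \<open>m \<ge> k\<close> keeps every
  intermediate exponent natural, which is where the equation for \<open>G\<close> is available.
\<close>

lemma iterated_functional_equation:
  assumes G: "G \<in> op_families"
    and b: "\<And>m::nat. G (of_nat m) (f ^ (m + 1)) = scale (poly b (of_nat m)) (f ^ m)"
  shows "\<exists>H\<in>op_families. \<forall>m\<ge>k. H (of_nat m) (f ^ m) =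
    scale (\<Prod>i<k. poly b (of_nat m - of_nat (Suc i))) (f ^ (m - k))"
proof (induction k)
  case 0
  have "(\<lambda>x. 1 * x) \<in> diff_ops scale" by (rule diff_ops_mult)
  then show ?case by (intro bexI[OF _ op_families.const]) auto
next
  case (Suc k)
  then obtain H where H: "H \<in> op_families" "\<And>m. m \<ge> k \<Longrightarrow> H (of_nat m) (f ^ m) =
    scale (\<Prod>i<k. poly b (of_nat m - of_nat (Suc i))) (f ^ (m - k))" by blast
  let ?G = "\<lambda>a. G (a + - of_nat (Suc k))"
  have "?G (of_nat m) (H (of_nat m) (f ^ m)) =
      scale (\<Prod>i<Suc k. poly b (of_nat m - of_nat (Suc i))) (f ^ (m - Suc k))" if "m \<ge> Suc k" for m
  proof -
    interpret L: Vector_Spaces.linear scale scale "?G (of_nat m)"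
      using op_families_linear[OF G] .
    from that obtain l where m: "m = l + Suc k" by (metis add.commute le_Suc_ex)
    have "of_nat m + - of_nat (Suc k) = (of_nat l :: 'k)" by (simp add: m)
    moreover have "of_nat m - of_nat (Suc k) = (of_nat l :: 'k)" by (simp add: m)
    moreover have "m - k = l + 1" "m - Suc k = l" by (simp_all add: m)
    ultimately show ?thesis using H(2)[of m] that b[of l] L.scale by (simp add: mult.commute)
  qed
  then show ?case
    by (intro bexI[OF _ op_families_comp[OF H(1) op_families_translate[OF G, of "- of_nat (Suc k)"]]])
      blast
qed

end


section \<open>Expansion of the action on powers\<close>

lemma iter_comm_precomp: "iter_comm j g (\<lambda>x. \<delta> (h * x)) r = iter_comm j g \<delta> (h * r)"
  by (induction j arbitrary: r) (auto simp: mult.left_commute)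

text \<open>
  The numerator form of the rule \<open>\<delta> \<cdot> (h u) = h (\<delta> \<cdot> u) + [\<delta>, h] \<cdot> u\<close> in the localization.
\<close>

lemma act_num_commutator:
  "act_num t \<delta> (h * r) g = h * act_num t \<delta> r g + act_num t (\<lambda>x. \<delta> (h * x) - h * \<delta> x) r g"
proof -
  have "act_num t \<delta> (h * r) g = act_num t (\<lambda>x. \<delta> (h * x)) r g"
    by (simp add: act_num_def iter_comm_precomp)
  also have "(\<lambda>x. \<delta> (h * x)) = (\<lambda>x. h * \<delta> x + (\<delta> (h * x) - h * \<delta> x))" by simp
  finally show ?thesis by (simp only: act_num_add act_num_mult)
qed

lemma act_num_raise_order:
  assumes "\<delta> \<in> diff_ops_le scale t"
  shows "act_num (Suc t) \<delta> r g = g * act_num t \<delta> r g"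
  using iter_comm_eq_0[OF assms, of g]
  by (simp add: act_num_def sum_distrib_left Suc_diff_le algebra_simps del: iter_comm.simps)

lemma act_num_by_1: "act_num t \<delta> r 1 = \<delta> r"
proof -
  have "iter_comm (Suc j) 1 \<delta> r = 0" for j by (induction j) simp_all
  then show ?thesis unfolding act_num_def by (subst sum.atMost_shift) simp
qed

locale char_0_algebra = comm_algebra scale
  for scale :: "'k::field_char_0 \<Rightarrow> 'r::comm_ring_1 \<Rightarrow> 'r"
begin

text \<open>
  The common value of \<open>f^(t-a) (\<delta> f^a)\<close> in the localization, for integers \<open>a\<close> and \<open>\<delta>\<close> of order at most \<open>t\<close>: it is the
  Newton expansion in \<open>a\<close>, and the iterated commutators play the role of the finite differences.
  Multiplication by \<open>f^t\<close> clears the denominators.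
\<close>

definition power_symbol :: "'r \<Rightarrow> nat \<Rightarrow> ('r \<Rightarrow> 'r) \<Rightarrow> 'k \<Rightarrow> 'r" where
  "power_symbol f t \<delta> a = (\<Sum>j\<le>t. scale (a gchoose j) (f ^ (t - j) * iter_comm j f \<delta> 1))"

lemma power_symbol_0 [simp]: "power_symbol f 0 \<delta> a = \<delta> 1"
  by (simp add: power_symbol_def)

lemma power_symbol_at_0: "power_symbol f t \<delta> 0 = f ^ t * \<delta> 1"
  unfolding power_symbol_def by (subst sum.atMost_shift) simp

text \<open>
  Pascal's rule.  It matches the recursion \<open>\<delta> f^(a+1) = f (\<delta> f^a) + [\<delta>, f] f^a\<close>, which raises the exponent in one
  direction and lowers it in the other; so it drives both of the following inductions.
\<close>

lemma power_symbol_plus_1: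
  "power_symbol f (Suc t) \<delta> (a + 1) =
    power_symbol f (Suc t) \<delta> a + power_symbol f t (\<lambda>x. \<delta> (f * x) - f * \<delta> x) a"
  unfolding power_symbol_def
  by (simp only: sum.atMost_Suc_shift gbinomial_Suc_Suc iter_comm_Suc_shift scale_left_distrib
      sum.distrib diff_Suc_Suc) (simp add: add_ac)

text \<open>
  Two exponents with \<open>d - e = m - t\<close> allow either sign of \<open>m - t\<close>.  For \<open>m \<ge> t\<close> one may take \<open>e = 0\<close> and gets
  an exact formula for \<open>\<delta> f^m\<close>, free of torsion; the induction on \<open>m\<close> also passes through \<open>m < t\<close>.
\<close>

lemma apply_to_power:
  "\<delta> \<in> diff_ops_le scale t \<Longrightarrow> m + e = d + t \<Longrightarrow>
    f ^ e * \<delta> (f ^ m) = f ^ d * power_symbol f t \<delta> (of_nat m)"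
proof (induction m arbitrary: e d t \<delta>)
  case 0
  then show ?case by (simp add: power_symbol_at_0 power_add mult.assoc)
next
  case (Suc m)
  let ?\<epsilon> = "\<lambda>x. \<delta> (f * x) - f * \<delta> x"
  show ?case
  proof (cases t)
    case 0
    with Suc.prems obtain g where "\<delta> = (\<lambda>x. g * x)" by (auto simp: diff_ops_le_0_iff)
    moreover have "d = Suc m + e" using 0 Suc.prems by simp
    ultimately show ?thesis by (simp add: 0 power_add algebra_simps)
  next
    case (Suc u)
    have "f ^ e * \<delta> (f ^ Suc m) = f ^ Suc e * \<delta> (f ^ m) + f ^ e * ?\<epsilon> (f ^ m)"
      by (simp add: algebra_simps)
    also have "f ^ Suc e * \<delta> (f ^ m) = f ^ d * power_symbol f t \<delta> (of_nat m)"
      using Suc.prems by (intro Suc.IH) auto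
    also have "f ^ e * ?\<epsilon> (f ^ m) = f ^ d * power_symbol f u ?\<epsilon> (of_nat m)"
      using Suc.prems Suc by (intro Suc.IH) (auto simp: diff_ops_le_Suc_iff)
    finally show ?thesis
      using power_symbol_plus_1[of f u \<delta> "of_nat m"] by (simp add: Suc algebra_simps)
  qed
qed

text \<open>
  The numerator of \<open>\<delta> \<cdot> f^(-m)\<close> over the denominator \<open>f^(m(t+1))\<close>.  Solving the commutator rule for the action on
  \<open>f^(-(m+1))\<close> expresses it by \<open>\<delta>\<close> on \<open>f^(-m)\<close> and by \<open>[\<delta>, f]\<close>, of smaller order, on \<open>f^(-(m+1))\<close>.
\<close>

lemma act_on_inverse_power:
  "\<delta> \<in> diff_ops_le scale t \<Longrightarrow>
    f ^ t * act_num t \<delta> 1 (f ^ m) = f ^ (m * t) * power_symbol f t \<delta> (- of_nat m)"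
proof (induction t arbitrary: \<delta> m)
  case 0
  then show ?case by (simp add: act_num_def)
next
  case (Suc t)
  let ?\<epsilon> = "\<lambda>x. \<delta> (f * x) - f * \<delta> x"
  have \<epsilon>: "?\<epsilon> \<in> diff_ops_le scale t" using Suc.prems by (simp add: diff_ops_le_Suc_iff)
  note lower_order = Suc.IH[OF \<epsilon>] and \<delta> = Suc.prems
  show ?case
  proof (induction m)
    case 0
    show ?case by (simp add: act_num_by_1 power_symbol_at_0)
  next
    case (Suc m)
    let ?A = "act_num (Suc t) \<delta> 1" and ?S = "power_symbol f (Suc t) \<delta>"
    have "f ^ Suc (Suc t) * ?A (f ^ m) = f * ?A (f ^ Suc m) + f ^ Suc m * act_num t ?\<epsilon> 1 (f ^ Suc m)"
      using act_num_commutator[where t = "Suc t" and \<delta> = \<delta> and h = f and r = 1 and g = "f ^ Suc m"]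
        act_num_cancel[OF \<delta>, of f 1 "f ^ m"]
        act_num_raise_order[OF \<epsilon>, of 1 "f ^ Suc m"] by simp
    then have "f * ?A (f ^ Suc m) =
        f ^ Suc (Suc t) * ?A (f ^ m) - f ^ Suc m * act_num t ?\<epsilon> 1 (f ^ Suc m)" by simp
    then have "f ^ Suc t * ?A (f ^ Suc m) =
        f ^ t * (f ^ Suc (Suc t) * ?A (f ^ m) - f ^ Suc m * act_num t ?\<epsilon> 1 (f ^ Suc m))"
      by (simp add: mult.assoc power_commutes[symmetric])
    also have "\<dots> = f ^ Suc t * (f ^ Suc t * ?A (f ^ m)) -
        f ^ Suc m * (f ^ t * act_num t ?\<epsilon> 1 (f ^ Suc m))"
      by (simp add: algebra_simps)
    also have "\<dots> = f ^ Suc t * (f ^ (m * Suc t) * ?S (- of_nat m)) -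
        f ^ Suc m * (f ^ (Suc m * t) * power_symbol f t ?\<epsilon> (- of_nat (Suc m)))"
      by (simp only: Suc.IH lower_order)
    also have "\<dots> = f ^ (Suc m * Suc t) *
        (?S (- of_nat m) - power_symbol f t ?\<epsilon> (- of_nat (Suc m)))"
      by (simp add: algebra_simps power_add)
    also have "?S (- of_nat m) - power_symbol f t ?\<epsilon> (- of_nat (Suc m)) = ?S (- of_nat (Suc m))"
      using power_symbol_plus_1[of f t \<delta> "- of_nat (Suc m)"] by simp
    finally show ?case .
  qed
qed

text \<open>
  The left-hand side is a polynomial in \<open>a\<close>, as the characteristic is zero, and vanishes at \<open>a = -c\<close>.
\<close>

lemma gbinomial_minus_value:
  "\<exists>q. \<forall>a. (a + 1 gchoose j) - (1 - c gchoose j) = (a + c) * poly q (a::'k)"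
proof -
  define p where "p = smult (1 / fact j) (\<Prod>i<j. [:1 - of_nat i, 1:]) - [:1 - c gchoose j:]"
  have p: "poly p a = (a + 1 gchoose j) - (1 - c gchoose j)" for a
    by (simp add: p_def gbinomial_prod_rev poly_prod atLeast0LessThan algebra_simps)
  then have "poly p (- c) = 0" by simp
  then obtain q where "p = [:c, 1:] * q" by (auto simp: poly_eq_0_iff_dvd)
  then have "poly p a = (a + c) * poly q a" for a by (simp add: algebra_simps)
  with p show ?thesis by metis
qed

lemma power_symbol_minus_value:
  "\<exists>Q\<in>op_families. \<forall>a x. (power_symbol f t \<delta> (a + 1) - power_symbol f t \<delta> (1 - c)) * x =
    scale (a + c) (Q a x)"
proof -
  have "\<forall>j. \<exists>q. \<forall>a. (a + 1 gchoose j) - (1 - c gchoose j) = (a + c) * poly q a"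
    using gbinomial_minus_value by blast
  from choice[OF this] obtain q
    where q: "\<And>j a. (a + 1 gchoose j) - (1 - c gchoose j) = (a + c) * poly (q j) a" by blast
  let ?c = "\<lambda>j. f ^ (t - j) * iter_comm j f \<delta> 1"
  have "(\<lambda>a x. \<Sum>j\<le>t. scale (poly (q j) a) (?c j * x)) \<in> op_families"
    by (intro op_families_sum op_families_poly op_families.const diff_ops_mult) simp
  moreover have "(power_symbol f t \<delta> (a + 1) - power_symbol f t \<delta> (1 - c)) * x =
      scale (a + c) (\<Sum>j\<le>t. scale (poly (q j) a) (?c j * x))" for a x
  proof -
    have "(power_symbol f t \<delta> (a + 1) - power_symbol f t \<delta> (1 - c)) * x =
        (\<Sum>j\<le>t. scale ((a + 1 gchoose j) - (1 - c gchoose j)) (?c j)) * x"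
      by (simp only: power_symbol_def scale_left_diff_distrib sum_subtractf)
    then show ?thesis by (simp only: q sum_distrib_right scale_mult_left scale_sum_right scale_scale)
  qed
  ultimately show ?thesis by (intro bexI) auto
qed


section \<open>Lowering the multiplicity of a root\<close>

text \<open>
  With \<open>n = l + 1\<close>, this is the hypothesis \<open>\<delta> \<cdot> f^(-l) = f^(-n)\<close> with denominators cleared.  Equality of fractions
  holds up to a power of \<open>f\<close>, so the exponent \<open>m\<close> has to be large.
\<close>

lemma power_eq_symbol_if_generated:
  assumes \<delta>: "\<delta> \<in> diff_ops_le scale t"
    and eq: "loc_frac f 1 (f ^ Suc l) = loc_act scale f \<delta> (loc_frac f 1 (f ^ l))"
  shows "\<exists>N. \<forall>m\<ge>N. m \<ge> t \<and> f ^ m = f ^ (m - t) * f * power_symbol f t \<delta> (- of_nat l)"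
proof -
  have "loc_frac f 1 (f ^ Suc l) = loc_frac f (act_num t \<delta> 1 (f ^ l)) ((f ^ l) ^ (t + 1))"
    using eq loc_act_frac[OF comm_algebra_axioms \<delta>] by (simp add: act_frac_eq)
  then have "\<exists>h\<in>powers_of f. h * ((f ^ l) ^ (t + 1) - act_num t \<delta> 1 (f ^ l) * f ^ Suc l) = 0"
    by (simp add: loc_frac_eq_iff del: power_Suc)
  then obtain h where h: "f ^ h * ((f ^ l) ^ (t + 1) - act_num t \<delta> 1 (f ^ l) * f ^ Suc l) = 0"
    unfolding powers_of_def by blast
  let ?N = "h + l * t + l + t"
  have "f ^ ?N = f ^ t * (f ^ h * (f ^ l) ^ (t + 1))"
    by (simp add: power_add power_mult algebra_simps)
  also have "\<dots> = f ^ h * f ^ Suc l * (f ^ t * act_num t \<delta> 1 (f ^ l))"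
    using h by (simp add: algebra_simps)
  also have "\<dots> = f ^ (h + l * t + l) * f * power_symbol f t \<delta> (- of_nat l)"
    by (simp add: act_on_inverse_power[OF \<delta>] power_add algebra_simps)
  finally have N: "f ^ ?N = f ^ (h + l * t + l) * f * power_symbol f t \<delta> (- of_nat l)" .
  have "m \<ge> t \<and> f ^ m = f ^ (m - t) * f * power_symbol f t \<delta> (- of_nat l)" if "m \<ge> ?N" for m
  proof -
    from that obtain d where m: "m = ?N + d" using le_Suc_ex by blast
    then have "f ^ m = f ^ d * f ^ ?N" by (simp add: power_add mult.commute)
    also have "\<dots> = f ^ (h + l * t + l + d) * f * power_symbol f t \<delta> (- of_nat l)"
      unfolding N by (simp add: power_add algebra_simps)
    finally show ?thesis using m by (simp add: add_ac)
  qed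
  then show ?thesis by blast
qed

text \<open>
  A factor \<open>s + n\<close> of a functional equation can be traded for factors \<open>b(s - i)\<close> with \<open>i > 0\<close> and
  factors that vanish at small natural numbers.
\<close>

lemma bernstein_sato_ideal_reduced:
  assumes b: "[:of_nat n, 1:] * c \<in> bernstein_sato_ideal scale f" (is "?b \<in> _")
    and n: "n \<ge> 1" and \<delta>: "\<delta> \<in> diff_ops scale"
    and eq: "loc_frac f 1 (f ^ n) = loc_act scale f \<delta> (loc_frac f 1 (f ^ (n - 1)))"
  shows "\<exists>t N. c * ((\<Prod>i<t. pcompose ?b [:- of_nat (Suc i), 1:]) * (\<Prod>i<N. [:- of_nat i, 1:]))
    \<in> bernstein_sato_ideal scale f"
proof -
  let ?\<nu> = "of_nat n :: 'k"
  obtain t where t: "\<delta> \<in> diff_ops_le scale t" using \<delta> by (auto simp: diff_ops_def)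
  have l: "- of_nat (n - 1) = 1 - ?\<nu>" using n by (simp add: of_nat_diff)
  obtain N where N: "\<And>m. m \<ge> N \<Longrightarrow> m \<ge> t"
      "\<And>m. m \<ge> N \<Longrightarrow> f ^ m = f ^ (m - t) * f * power_symbol f t \<delta> (1 - ?\<nu>)"
    using power_eq_symbol_if_generated[OF t, of f "n - 1"] n eq unfolding l by auto
  obtain G where G: "G \<in> op_families"
      "\<And>m::nat. G (of_nat m) (f ^ (m + 1)) = scale (poly ?b (of_nat m)) (f ^ m)"
    using b unfolding bernstein_sato_ideal_iff_family by blast
  define B where "B = (\<Prod>i<t. pcompose ?b [:- of_nat (Suc i), 1:])"
  define Z :: "'k poly" where "Z = (\<Prod>i<N. [:- of_nat i, 1:])"
  have B: "poly B a = (\<Prod>i<t. poly ?b (a - of_nat (Suc i)))" for a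
    unfolding B_def poly_prod poly_pcompose by (simp add: algebra_simps)
  obtain H where H: "H \<in> op_families"
      "\<And>m. m \<ge> t \<Longrightarrow> H (of_nat m) (f ^ m) = scale (poly B (of_nat m)) (f ^ (m - t))"
    using iterated_functional_equation[OF G, of t] unfolding B by blast
  obtain Q where Q: "Q \<in> op_families"
      "\<And>a x. (power_symbol f t \<delta> (a + 1) - power_symbol f t \<delta> (1 - ?\<nu>)) * x = scale (a + ?\<nu>) (Q a x)"
    using power_symbol_minus_value by blast
  \<comment> \<open>For \<open>m \<ge> N\<close>, the summand with \<open>Q\<close> cancels the error term in \<open>\<delta> f^(m+1) = f^m + (m + n) Q(m) f \<cdot> f^(m-t)\<close>,
    multiplied by \<open>c B\<close>; for \<open>m < N\<close> both sides are killed by \<open>Z\<close>.\<close>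
  define F where "F = (\<lambda>a x. scale (poly Z a)
    (scale (poly (c * B) a) (\<delta> x) - Q a (f * H a (G a x))))"
  have "F \<in> op_families"
    unfolding F_def by (intro op_families_poly op_families_diff op_families.const \<delta>
      op_families_comp[OF _ Q(1)] op_families_comp_const[OF diff_ops_mult]
      op_families_comp[OF G(1) H(1)])
  moreover have "F (of_nat m) (f ^ (m + 1)) = scale (poly (c * (B * Z)) (of_nat m)) (f ^ m)" for m
  proof (cases "m < N")
    case True
    then have "poly Z (of_nat m) = 0" by (auto simp: Z_def poly_prod)
    then show ?thesis by (simp add: F_def)
  next
    case False
    then have m: "m \<ge> N" by simp
    let ?m = "of_nat m :: 'k"
    interpret LQ: Vector_Spaces.linear scale scale "Q ?m" by (rule op_families_linear[OF Q(1)])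
    interpret LH: Vector_Spaces.linear scale scale "H ?m" by (rule op_families_linear[OF H(1)])
    have "m + 1 + 0 = (m - t + 1) + t" using N(1)[OF m] by simp
    from apply_to_power[OF t this, of f]
    have "\<delta> (f ^ (m + 1)) = power_symbol f t \<delta> (?m + 1) * (f * f ^ (m - t))"
      by (simp add: algebra_simps)
    also have "\<dots> = f ^ m + (power_symbol f t \<delta> (?m + 1) - power_symbol f t \<delta> (1 - ?\<nu>)) *
        (f * f ^ (m - t))"
      by (subst N(2)[OF m]) (simp add: algebra_simps)
    finally have 1: "\<delta> (f ^ (m + 1)) = f ^ m + scale (?m + ?\<nu>) (Q ?m (f * f ^ (m - t)))"
      by (simp only: Q(2))
    have 2: "Q ?m (f * H ?m (G ?m (f ^ (m + 1)))) =
        scale (poly ?b ?m * poly B ?m) (Q ?m (f * f ^ (m - t)))"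
      using N(1)[OF m] by (simp only: G(2) LH.scale H(2) LQ.scale scale_mult_right scale_scale)
    have "poly ?b ?m = poly c ?m * (?m + ?\<nu>)" by (simp add: algebra_simps)
    then have "scale (poly (c * B) ?m) (\<delta> (f ^ (m + 1))) - Q ?m (f * H ?m (G ?m (f ^ (m + 1)))) =
        scale (poly (c * B) ?m) (f ^ m)"
      unfolding 1 2 by (simp add: scale_right_distrib mult_ac)
    then show ?thesis unfolding F_def by (simp add: mult_ac)
  qed
  ultimately have "c * (B * Z) \<in> bernstein_sato_ideal scale f"
    unfolding bernstein_sato_ideal_iff_family by blast
  then show ?thesis unfolding B_def Z_def by blast
qed

end

lemma cyclic_submodule_subset_carrier:
  assumes "comm_algebra scale" "g \<in> powers_of f"
  shows "cyclic_submodule scale f (loc_frac f r g) \<subseteq> carrier (localization f)"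
  using loc_act_frac[OF assms(1) _ assms(2), of _ _ r] assms(2)
  by (auto simp: cyclic_submodule_def diff_ops_def act_frac_eq simp del: power_Suc)

theorem proposition8p2:
  fixes scale :: "'k::field_char_0 \<Rightarrow> 'r::comm_ring_1 \<Rightarrow> 'r"
    and f :: 'r and n :: nat
  assumes "comm_algebra scale"
    and "has_bernstein_sato_poly scale f"
    and "n \<ge> 1"
    and "poly (bernstein_sato_poly scale f) (of_int (- int n)) = 0"
    and "\<And>k::int. poly (bernstein_sato_poly scale f) (of_int k) = 0 \<Longrightarrow> - int n \<le> k"
  shows "loc_frac f 1 (f ^ n) \<notin> cyclic_submodule scale f (loc_frac f 1 (f ^ (n - 1)))
    \<and> cyclic_submodule scale f (loc_frac f 1 (f ^ (n - 1))) \<subseteq> carrier (localization f)"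
proof
  interpret comm_algebra scale by fact
  interpret char_0_algebra scale ..
  let ?b = "bernstein_sato_poly scale f"
  have b: "lead_coeff ?b = 1" "bernstein_sato_ideal scale f = {p. ?b dvd p}"
    using bernstein_sato_poly_generates[OF assms(1,2)] by blast+
  from assms(4) have "[:of_nat n, 1:] dvd ?b" by (simp add: poly_eq_0_iff_dvd)
  then obtain c where c: "?b = [:of_nat n, 1:] * c" by (rule dvdE)
  have "c \<noteq> 0" using b(1) c by auto
  show "loc_frac f 1 (f ^ n) \<notin> cyclic_submodule scale f (loc_frac f 1 (f ^ (n - 1)))"
  proof
    assume "loc_frac f 1 (f ^ n) \<in> cyclic_submodule scale f (loc_frac f 1 (f ^ (n - 1)))"
    then obtain \<delta> where \<delta>: "\<delta> \<in> diff_ops scale"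
        "loc_frac f 1 (f ^ n) = loc_act scale f \<delta> (loc_frac f 1 (f ^ (n - 1)))"
      by (auto simp: cyclic_submodule_def)
    have "[:of_nat n, 1:] * c \<in> bernstein_sato_ideal scale f"
      unfolding b(2) c[symmetric] by simp
    from bernstein_sato_ideal_reduced[OF this assms(3) \<delta>] obtain t N where
      "c * ((\<Prod>i<t. pcompose ?b [:- of_nat (Suc i), 1:]) * (\<Prod>i<N. [:- of_nat i, 1:]))
        \<in> bernstein_sato_ideal scale f"
      unfolding c[symmetric] by blast
    moreover define X where
      "X = (\<Prod>i<t. pcompose ?b [:- of_nat (Suc i), 1:]) * (\<Prod>i<N. [:- of_nat i, 1:])"
    ultimately have "?b dvd c * X" unfolding b(2) by simp
    then have "c * [:of_nat n, 1:] dvd c * X" unfolding c by (simp only: mult.commute)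
    \<comment> \<open>The factor \<open>s + n\<close> that \<open>b\<close> has in addition to \<open>c\<close> is left for \<open>X\<close>.\<close>
    then have "[:- (- of_nat n), 1:] dvd X"
      using \<open>c \<noteq> 0\<close> by (simp only: dvd_mult_cancel_left) simp
    then have "poly X (- of_nat n) = 0" by (simp only: poly_eq_0_iff_dvd)
    then have "(\<Prod>i<t. poly ?b (- of_nat (Suc i) - of_nat n)) *
        (\<Prod>i<N. - of_nat i - of_nat n) = (0::'k)"
      unfolding X_def by (simp add: poly_prod poly_pcompose)
    then consider i where "poly ?b (of_int (- int (Suc i) - int n)) = 0"
      | i :: nat where "- of_nat i - of_nat n = (0::'k)"
      by auto
    then show False
    proof cases
      \<comment> \<open>The integer \<open>-n - i - 1\<close> would be a root of \<open>b\<close> smaller than \<open>-n\<close>.\<close>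
      case (1 i)
      from assms(5)[OF 1] show False by simp
    next
      case (2 i)
      have "of_nat (n + i) = - (- of_nat i - of_nat n :: 'k)" by simp
      then have "of_nat (n + i) = (0::'k)" unfolding 2 by simp
      with assms(3) show False by (simp only: of_nat_eq_0_iff)
    qed
  qed
  show "cyclic_submodule scale f (loc_frac f 1 (f ^ (n - 1))) \<subseteq> carrier (localization f)"
    by (intro cyclic_submodule_subset_carrier assms(1)) simp
qed

end
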